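(* Let $f,g_1,\dots,g_m:\mathbb{R}^n\to\mathbb{R}$ be continuously differentiable, consider the problem of minimizing $f(x)$ subject to $g_i(x)\le 0$ for all $i\in[m]$, and let $\mathcal{F}=\{x\in\mathbb{R}^n: g_i(x)\le 0\ \forall i\in[m]\}$. Assume that: (i) $f$ is $L_f$-smooth and each $g_i$ is $L_i$-smooth; (ii) the problem is feasible and bounded below, and its optimal value is attained at some $x^\star\in\mathcal{F}$; (iii) MFCQ holds at every point of $\mathcal{F}$. Fix $\alpha>0$ and $w_1,\dots,w_m>0$, let $x\in\mathcal{F}$, and let $u(x)$ be the solution of the QCQP given in the context. Then: 1. $u(x)=0$ if and only if $x$ is a stationary point of the problem. 2. $u(x)$ is a descent direction for $f$, in the sense that $\nabla f(x)^\top u(x)\le-\|u(x)\|_2^2$.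
   Context: $[m]=\{1,\dots,m\}$. A continuously differentiable function is $L$-smooth if its gradient is $L$-Lipschitz in the Euclidean norm. The Mangasarian-Fromovitz constraint qualification (MFCQ) holds at $x$ if there exists $d\in\mathbb{R}^n$ with $\nabla g_i(x)^\top d<0$ for all $i\in\mathcal{I}(x)$, where $\mathcal{I}(x)=\{i\in[m]:g_i(x)=0\}$. A point $x$ is stationary for the problem if there exists $\lambda\in\mathbb{R}^m$ such that $\nabla f(x)+\sum_{i=1}^m\lambda_i\nabla g_i(x)=0$, $g_i(x)\le0$ for all $i$, $\lambda\ge0$, and $\lambda_ig_i(x)=0$ for all $i$ (KKT conditions). The direction $u(x)$ is the unique minimizer of the convex QCQP $$u(x):=\arg\min_{u\in\mathbb{R}^n}\ \tfrac12\|u+\nabla f(x)\|_2^2\quad\text{s.t.}\quad \nabla g_i(x)^\top u\le-\alpha g_i(x)-w_i\|u\|_2^2\quad\forall i\in[m].$$ *)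

theory Defs
  imports "HOL-Analysis.Analysis"
begin

definition gradient :: "(real ^ 'n \<Rightarrow> real) \<Rightarrow> real ^ 'n \<Rightarrow> real ^ 'n" where
  "gradient f x = (THE D. GDERIV f x :> D)"

lemma gradient_eq:
  assumes "GDERIV f x :> D"
  shows "gradient f x = D"
proof -
  have "D' = D" if "GDERIV f x :> D'" for D'
  proof -
    have "(\<lambda>h. h \<bullet> D') = (\<lambda>h. h \<bullet> D)"
      using that assms unfolding gderiv_def by (rule has_derivative_unique)
    then show ?thesis
      by (metis vector_eq_ldot)
  qed
  with assms show ?thesis
    unfolding gradient_def by blast
qed

lemma GDERIV_gradient:
  fixes f :: "real ^ 'n \<Rightarrow> real"
  assumes "f differentiable (at x)"
  shows "GDERIV f x :> gradient f x"
proof -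
  obtain f' where f': "(f has_derivative f') (at x)"
    using assms unfolding differentiable_def by blast
  then have "linear f'"
    by (rule has_derivative_linear)
  then have "f' h = h \<bullet> adjoint f' 1" for h
    using adjoint_works[of f' h 1] by (simp add: inner_commute)
  then have "f' = (\<lambda>h. h \<bullet> adjoint f' 1)"
    by blast
  with f' have "GDERIV f x :> adjoint f' 1"
    unfolding gderiv_def by simp
  then show ?thesis
    using gradient_eq by metis
qed

definition continuously_differentiable :: "(real ^ 'n \<Rightarrow> real) \<Rightarrow> bool" where
  "continuously_differentiable f \<longleftrightarrow>
     (\<forall>x. f differentiable (at x)) \<and> continuous_on UNIV (gradient f)"

definition L_smooth :: "real \<Rightarrow> (real ^ 'n \<Rightarrow> real) \<Rightarrow> bool" where
  "L_smooth L f \<longleftrightarrow> continuously_differentiable f \<and> L-lipschitz_on UNIV (gradient f)"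

text \<open>
  The problem is to minimize \<open>f x\<close> subject to \<open>g i x \<le> 0\<close> for \<open>i \<in> {1..m}\<close>. Families indexed
  by \<open>{1..m}\<close> are functions on \<open>nat\<close> of which only the values on \<open>{1..m}\<close> are used.
\<close>

definition feasible_set :: "nat \<Rightarrow> (nat \<Rightarrow> real ^ 'n \<Rightarrow> real) \<Rightarrow> (real ^ 'n) set" where
  "feasible_set m g = {x. \<forall>i\<in>{1..m}. g i x \<le> 0}"

definition active_set :: "nat \<Rightarrow> (nat \<Rightarrow> real ^ 'n \<Rightarrow> real) \<Rightarrow> real ^ 'n \<Rightarrow> nat set" where
  "active_set m g x = {i\<in>{1..m}. g i x = 0}"

definition MFCQ :: "nat \<Rightarrow> (nat \<Rightarrow> real ^ 'n \<Rightarrow> real) \<Rightarrow> real ^ 'n \<Rightarrow> bool" where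
  "MFCQ m g x \<longleftrightarrow> (\<exists>d. \<forall>i\<in>active_set m g x. gradient (g i) x \<bullet> d < 0)"

definition stationary ::
    "nat \<Rightarrow> (real ^ 'n \<Rightarrow> real) \<Rightarrow> (nat \<Rightarrow> real ^ 'n \<Rightarrow> real) \<Rightarrow> real ^ 'n \<Rightarrow> bool" where
  "stationary m f g x \<longleftrightarrow>
     (\<exists>lam :: nat \<Rightarrow> real.
        gradient f x + (\<Sum>i=1..m. lam i *\<^sub>R gradient (g i) x) = 0 \<and>
        (\<forall>i\<in>{1..m}. g i x \<le> 0) \<and>
        (\<forall>i\<in>{1..m}. lam i \<ge> 0) \<and>
        (\<forall>i\<in>{1..m}. lam i * g i x = 0))"

definition qcqp_feasible ::
    "nat \<Rightarrow> (nat \<Rightarrow> real ^ 'n \<Rightarrow> real) \<Rightarrow> real \<Rightarrow> (nat \<Rightarrow> real) \<Rightarrow> real ^ 'n \<Rightarrow> real ^ 'n \<Rightarrow> bool" where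
  "qcqp_feasible m g \<alpha> w x u \<longleftrightarrow>
     (\<forall>i\<in>{1..m}. gradient (g i) x \<bullet> u \<le> - \<alpha> * g i x - w i * (norm u)\<^sup>2)"

text \<open>
  The description picks the unique minimizer; its existence and uniqueness are not part of the
  definition and have to be proved.
\<close>

definition qcqp_direction ::
    "nat \<Rightarrow> (real ^ 'n \<Rightarrow> real) \<Rightarrow> (nat \<Rightarrow> real ^ 'n \<Rightarrow> real) \<Rightarrow> real \<Rightarrow> (nat \<Rightarrow> real) \<Rightarrow>
     real ^ 'n \<Rightarrow> real ^ 'n" where
  "qcqp_direction m f g \<alpha> w x =
     (THE u. is_arg_min (\<lambda>u. 1 / 2 * (norm (u + gradient f x))\<^sup>2) (qcqp_feasible m g \<alpha> w x) u)"

end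

theory Submission imports Defs begin

text \<open>
  The direction \<open>u x\<close> is the Euclidean projection of \<open>- gradient f x\<close> onto the closed convex
  feasible set \<open>K\<close> of the QCQP, which contains \<open>0\<close>. The obtuse angle property of the projection,
  tested at \<open>0\<close>, is the descent inequality, and \<open>u x = 0\<close> says that \<open>gradient f x \<bullet> v \<ge> 0\<close> on \<open>K\<close>.
  The KKT conditions clearly imply the latter. Conversely, if \<open>y\<close> has nonpositive inner product
  with all active gradients and \<open>d\<close> is an MFCQ direction, then a small positive multiple of
  \<open>y + e d\<close> lies in \<open>K\<close> for every \<open>e > 0\<close>; letting \<open>e\<close> tend to \<open>0\<close> gives
  \<open>gradient f x \<bullet> y \<ge> 0\<close>, and Farkas' lemma provides the multipliers.
\<close>

section \<open>Farkas' lemma by separation from a finitely generated cone\<close>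

lemma farkas:
  fixes a :: "'i \<Rightarrow> 'a::euclidean_space"
  assumes "finite I"
    and polar: "\<And>y. \<forall>i\<in>I. a i \<bullet> y \<le> 0 \<Longrightarrow> z \<bullet> y \<le> 0"
  obtains lam where "\<And>i. i \<in> I \<Longrightarrow> 0 \<le> lam i" "z = (\<Sum>i\<in>I. lam i *\<^sub>R a i)"
proof -
  let ?C = "convex_cone hull (a ` I)"
  let ?S = "{v. \<exists>lam. (\<forall>i\<in>I. 0 \<le> lam i) \<and> v = (\<Sum>i\<in>I. lam i *\<^sub>R a i)}"
  have "z \<in> ?C"
  proof (rule ccontr)
    \<comment> \<open>A finitely generated cone is closed, so an outside point can be strictly
      separated from it; since the cone contains \<open>0\<close>, the level \<open>b\<close> is
      negative.\<close>
    assume "z \<notin> ?C"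
    then obtain n b where sep: "n \<bullet> z < b" "\<And>v. v \<in> ?C \<Longrightarrow> b < n \<bullet> v"
      using separating_hyperplane_closed_point[OF convex_convex_cone_hull
          closed_convex_cone_hull[OF finite_imageI[OF \<open>finite I\<close>]]] by metis
    have "b < 0"
      using sep(2)[OF convex_cone_hull_contains_0] by simp
    have "0 \<le> n \<bullet> a i" if "i \<in> I" for i
    proof (rule ccontr)
      assume neg: "\<not> 0 \<le> n \<bullet> a i"
      \<comment> \<open>The factor is positive, and the scaled generator has inner product exactly
        \<open>b\<close> with \<open>n\<close>, against the strict separation.\<close>
      then have "(b / (n \<bullet> a i)) *\<^sub>R a i \<in> ?C"
        using that \<open>b < 0\<close> by (intro convex_cone_hull_mul hull_inc) (auto intro: divide_nonpos_nonpos)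
      from sep(2)[OF this] neg show False
        by simp
    qed
    then have "z \<bullet> (- n) \<le> 0"
      by (intro polar) (simp add: inner_commute)
    with sep(1) \<open>b < 0\<close> show False
      by (simp add: inner_commute)
  qed
  \<comment> \<open>The nonnegative combinations form a convex cone containing the generators, so
    the hull, being minimal, lies inside them.\<close>
  also have "?C \<subseteq> ?S"
  proof (rule hull_minimal)
    show "a ` I \<subseteq> ?S"
    proof clarify
      fix i assume "i \<in> I"
      then have "a i = (\<Sum>j\<in>I. (if j = i then 1 else 0) *\<^sub>R a j)"
        using \<open>finite I\<close> by (simp add: if_distrib[of "\<lambda>c. c *\<^sub>R _"] cong: if_cong)
      then show "\<exists>lam. (\<forall>j\<in>I. 0 \<le> lam j) \<and> a i = (\<Sum>j\<in>I. lam j *\<^sub>R a j)"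
        by (intro exI[of _ "\<lambda>j. if j = i then 1 else 0"]) simp
    qed
    show "convex_cone ?S"
      unfolding convex_cone_iff
    proof (intro conjI ballI allI impI)
      show "0 \<in> ?S"
        by (auto intro!: exI[of _ "\<lambda>_. 0"])
    next
      fix u v assume "u \<in> ?S" "v \<in> ?S"
      then obtain p q where "\<forall>i\<in>I. 0 \<le> p i" "u = (\<Sum>i\<in>I. p i *\<^sub>R a i)"
        "\<forall>i\<in>I. 0 \<le> q i" "v = (\<Sum>i\<in>I. q i *\<^sub>R a i)"
        by blast
      then show "u + v \<in> ?S"
        by (auto intro!: exI[of _ "\<lambda>i. p i + q i"] simp: scaleR_add_left sum.distrib)
    next
      fix u and c :: real assume "u \<in> ?S" "0 \<le> c"
      then obtain p where "\<forall>i\<in>I. 0 \<le> p i" "u = (\<Sum>i\<in>I. p i *\<^sub>R a i)"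
        by blast
      with \<open>0 \<le> c\<close> show "c *\<^sub>R u \<in> ?S"
        by (auto intro!: exI[of _ "\<lambda>i. c * p i"] simp: scaleR_sum_right)
    qed
  qed
  finally show ?thesis
    using that by blast
qed

section \<open>The QCQP as projection onto a closed convex set\<close>

lemma norm_power2_convex_combination_le:
  fixes x y :: "'a::real_inner"
  assumes "0 \<le> s" "0 \<le> t" "s + t = 1"
  shows "(norm (s *\<^sub>R x + t *\<^sub>R y))\<^sup>2 \<le> s * (norm x)\<^sup>2 + t * (norm y)\<^sup>2"
proof -
  \<comment> \<open>Eliminating \<open>s\<close> turns the next equation into a polynomial identity
    in inner products.\<close>
  have s: "s = 1 - t"
    using assms by simp
  have "s * (norm x)\<^sup>2 + t * (norm y)\<^sup>2 - (norm (s *\<^sub>R x + t *\<^sub>R y))\<^sup>2 = s * t * (norm (x - y))\<^sup>2"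
    unfolding power2_norm_eq_inner s by (simp add: inner_simps inner_commute) algebra
  moreover have "0 \<le> s * t * (norm (x - y))\<^sup>2"
    using assms by simp
  ultimately show ?thesis
    by linarith
qed

text \<open>Each constraint bounds the function
  \<open>gradient (g i) x \<bullet> u + w i * (norm u)\<^sup>2\<close> of \<open>u\<close> from
  above, and this function is convex because \<open>w i\<close> is nonnegative.\<close>

lemma convex_qcqp_feasible:
  assumes "\<forall>i\<in>{1..m}. 0 \<le> w i"
  shows "convex (Collect (qcqp_feasible m g \<alpha> w x))"
proof (rule convexI)
  fix u v and s t :: real
  assume uv: "u \<in> Collect (qcqp_feasible m g \<alpha> w x)" "v \<in> Collect (qcqp_feasible m g \<alpha> w x)"
    and st: "0 \<le> s" "0 \<le> t" "s + t = 1"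
  have "gradient (g i) x \<bullet> (s *\<^sub>R u + t *\<^sub>R v)
      \<le> - \<alpha> * g i x - w i * (norm (s *\<^sub>R u + t *\<^sub>R v))\<^sup>2" if i: "i \<in> {1..m}" for i
  proof -
    let ?a = "gradient (g i) x" and ?b = "- \<alpha> * g i x"
    have "?a \<bullet> (s *\<^sub>R u + t *\<^sub>R v) = s * (?a \<bullet> u) + t * (?a \<bullet> v)"
      by (simp add: inner_simps)
    also have "\<dots> \<le> s * (?b - w i * (norm u)\<^sup>2) + t * (?b - w i * (norm v)\<^sup>2)"
      using uv st i by (intro add_mono mult_left_mono) (auto simp: qcqp_feasible_def)
    also have "\<dots> = (s + t) * ?b - w i * (s * (norm u)\<^sup>2 + t * (norm v)\<^sup>2)"
      by (simp add: algebra_simps)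
    also have "\<dots> \<le> ?b - w i * (norm (s *\<^sub>R u + t *\<^sub>R v))\<^sup>2"
      using mult_left_mono[OF norm_power2_convex_combination_le[OF st, of u v], of "w i"] assms i st(3)
      by simp
    finally show ?thesis .
  qed
  then show "s *\<^sub>R u + t *\<^sub>R v \<in> Collect (qcqp_feasible m g \<alpha> w x)"
    by (simp add: qcqp_feasible_def)
qed

lemma closed_qcqp_feasible: "closed (Collect (qcqp_feasible m g \<alpha> w x))"
proof -
  have "Collect (qcqp_feasible m g \<alpha> w x) =
      (\<Inter>i\<in>{1..m}. {u. gradient (g i) x \<bullet> u \<le> - \<alpha> * g i x - w i * (norm u)\<^sup>2})"
    by (auto simp: qcqp_feasible_def)
  then show ?thesis
    by (auto intro!: closed_INT closed_Collect_le continuous_intros)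
qed

lemma qcqp_feasible_0:
  assumes "x \<in> feasible_set m g" "0 \<le> \<alpha>"
  shows "qcqp_feasible m g \<alpha> w x 0"
  using assms by (auto simp: qcqp_feasible_def feasible_set_def mult_nonneg_nonpos)

text \<open>The objective is half the squared distance to \<open>- gradient f x\<close>, so both
  problems have the same minimizers. Existence and uniqueness of the projection justify the definite
  description.\<close>

lemma qcqp_direction_eq_closest_point:
  assumes "\<forall>i\<in>{1..m}. 0 \<le> w i" "0 \<le> \<alpha>" "x \<in> feasible_set m g"
  shows "qcqp_direction m f g \<alpha> w x
    = closest_point (Collect (qcqp_feasible m g \<alpha> w x)) (- gradient f x)"
proof -
  let ?K = "Collect (qcqp_feasible m g \<alpha> w x)" and ?c = "gradient f x"
  have arg_min_iff: "is_arg_min (\<lambda>u. 1 / 2 * (norm (u + ?c))\<^sup>2) (qcqp_feasible m g \<alpha> w x) u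
      \<longleftrightarrow> u \<in> ?K \<and> (\<forall>v\<in>?K. dist (- ?c) u \<le> dist (- ?c) v)" for u
  proof -
    have "dist (- ?c) v = norm (v + ?c)" for v
      by (simp add: dist_norm norm_minus_commute[of "- ?c"])
    then show ?thesis
      by (auto simp: is_arg_min_linorder power_mono_iff)
  qed
  have "?K \<noteq> {}"
    using qcqp_feasible_0[OF assms(3,2)] by auto
  then show ?thesis
    unfolding qcqp_direction_def arg_min_iff
    using closest_point_exists[OF closed_qcqp_feasible, of m g \<alpha> w x "- ?c"]
    by (intro the_equality conjI
        closest_point_unique[OF convex_qcqp_feasible[OF assms(1)] closed_qcqp_feasible]) auto
qed

lemma qcqp_direction_descent:
  assumes "\<forall>i\<in>{1..m}. 0 \<le> w i" "0 \<le> \<alpha>" "x \<in> feasible_set m g"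
  shows "gradient f x \<bullet> qcqp_direction m f g \<alpha> w x \<le> - (norm (qcqp_direction m f g \<alpha> w x))\<^sup>2"
proof -
  let ?u = "qcqp_direction m f g \<alpha> w x"
  have "(- gradient f x - ?u) \<bullet> (0 - ?u) \<le> 0"
    unfolding qcqp_direction_eq_closest_point[OF assms]
    using qcqp_feasible_0[OF assms(3,2)]
    by (intro closest_point_dot convex_qcqp_feasible[OF assms(1)] closed_qcqp_feasible) auto
  then show ?thesis
    by (simp add: inner_diff_left power2_norm_eq_inner)
qed

text \<open>If \<open>?u = 0\<close>, the obtuse angle inequality at \<open>v\<close> reads
  \<open>- gradient f x \<bullet> v \<le> 0\<close>. Conversely, \<open>?u\<close> is itself
  feasible, so \<open>?R\<close> at \<open>?u\<close> and the descent inequality force its norm to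
  vanish.\<close>

lemma qcqp_direction_eq_0_iff:
  assumes "\<forall>i\<in>{1..m}. 0 \<le> w i" "0 \<le> \<alpha>" "x \<in> feasible_set m g"
  shows "qcqp_direction m f g \<alpha> w x = 0
    \<longleftrightarrow> (\<forall>v. qcqp_feasible m g \<alpha> w x v \<longrightarrow> 0 \<le> gradient f x \<bullet> v)"
    (is "?u = 0 \<longleftrightarrow> ?R")
proof
  assume "?u = 0"
  show ?R
  proof (intro allI impI)
    fix v assume "qcqp_feasible m g \<alpha> w x v"
    then have "(- gradient f x - ?u) \<bullet> (v - ?u) \<le> 0"
      unfolding qcqp_direction_eq_closest_point[OF assms]
      by (intro closest_point_dot convex_qcqp_feasible[OF assms(1)] closed_qcqp_feasible) auto
    with \<open>?u = 0\<close> show "0 \<le> gradient f x \<bullet> v"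
      by simp
  qed
next
  assume ?R
  moreover have "qcqp_feasible m g \<alpha> w x ?u"
    unfolding qcqp_direction_eq_closest_point[OF assms]
    using closest_point_in_set[OF closed_qcqp_feasible] qcqp_feasible_0[OF assms(3,2)] by blast
  ultimately have "0 \<le> gradient f x \<bullet> ?u"
    by blast
  moreover have "gradient f x \<bullet> ?u \<le> - (norm ?u)\<^sup>2"
    by (rule qcqp_direction_descent[OF assms])
  ultimately show "?u = 0"
    by (smt (verit) power2_eq_iff_nonneg power2_less_0 zero_less_norm_iff zero_less_power)
qed

section \<open>KKT conditions and the sign of \<open>gradient f x\<close> on the QCQP feasible
  set\<close>

lemma stationary_imp_inner_nonneg:
  assumes "stationary m f g x" "qcqp_feasible m g \<alpha> w x v" "\<forall>i\<in>{1..m}. 0 \<le> w i"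
  shows "0 \<le> gradient f x \<bullet> v"
proof -
  obtain lam where kkt: "gradient f x + (\<Sum>i=1..m. lam i *\<^sub>R gradient (g i) x) = 0"
    "\<And>i. i \<in> {1..m} \<Longrightarrow> 0 \<le> lam i" "\<And>i. i \<in> {1..m} \<Longrightarrow> lam i * g i x = 0"
    using assms(1) unfolding stationary_def by blast
  have "lam i * (gradient (g i) x \<bullet> v) \<le> 0" if i: "i \<in> {1..m}" for i
  proof -
    have "lam i * (gradient (g i) x \<bullet> v) \<le> lam i * (- \<alpha> * g i x - w i * (norm v)\<^sup>2)"
      using assms(2) kkt(2)[OF i] i by (intro mult_left_mono) (auto simp: qcqp_feasible_def)
    \<comment> \<open>Regrouped so that complementary slackness removes the first term; the second
      has the right sign.\<close>
    also have "\<dots> = - \<alpha> * (lam i * g i x) - lam i * w i * (norm v)\<^sup>2"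
      by (simp add: algebra_simps)
    also have "\<dots> \<le> 0"
      unfolding kkt(3)[OF i] using kkt(2)[OF i] assms(3) i by simp
    finally show ?thesis .
  qed
  then have "(\<Sum>i=1..m. lam i *\<^sub>R gradient (g i) x) \<bullet> v \<le> 0"
    by (auto simp: inner_sum_left intro: sum_nonpos)
  moreover have "gradient f x = - (\<Sum>i=1..m. lam i *\<^sub>R gradient (g i) x)"
    using kkt(1) by (simp add: eq_neg_iff_add_eq_0)
  ultimately show ?thesis
    by simp
qed

text \<open>For an active constraint, dividing by \<open>t\<close> leaves a strictly negative linear
  term plus a term of order \<open>t\<close>. For an inactive one, the bound
  \<open>- \<alpha> * g i x\<close> is strictly positive while the other terms tend to
  \<open>0\<close>.\<close>

lemma eventually_qcqp_feasible_scaleR: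
  assumes "x \<in> feasible_set m g" "0 < \<alpha>"
    and "\<And>i. i \<in> active_set m g x \<Longrightarrow> gradient (g i) x \<bullet> p < 0"
  shows "\<forall>\<^sub>F t in at_right 0. qcqp_feasible m g \<alpha> w x (t *\<^sub>R p)"
proof -
  have "\<forall>\<^sub>F t in at_right 0.
      gradient (g i) x \<bullet> (t *\<^sub>R p) \<le> - \<alpha> * g i x - w i * (norm (t *\<^sub>R p))\<^sup>2"
    if i: "i \<in> {1..m}" for i
  proof (cases "g i x = 0")
    case True
    have "((\<lambda>t. gradient (g i) x \<bullet> p + w i * t * (norm p)\<^sup>2)
        \<longlongrightarrow> gradient (g i) x \<bullet> p + w i * 0 * (norm p)\<^sup>2) (at_right 0)"
      by (intro tendsto_intros)
    moreover have "gradient (g i) x \<bullet> p + w i * 0 * (norm p)\<^sup>2 < 0"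
      using assms(3)[of i] i True by (simp add: active_set_def)
    ultimately have "\<forall>\<^sub>F t in at_right 0. gradient (g i) x \<bullet> p + w i * t * (norm p)\<^sup>2 < 0"
      by (rule order_tendstoD)
    then show ?thesis
      using eventually_at_right_less[of 0]
    proof eventually_elim
      case (elim t)
      then have "t * (gradient (g i) x \<bullet> p + w i * t * (norm p)\<^sup>2) \<le> 0"
        by (intro mult_nonneg_nonpos) auto
      then show ?case
        using True by (simp add: power_mult_distrib power2_eq_square algebra_simps)
    qed
  next
    case False
    have "((\<lambda>t. gradient (g i) x \<bullet> (t *\<^sub>R p) + w i * (norm (t *\<^sub>R p))\<^sup>2)
        \<longlongrightarrow> gradient (g i) x \<bullet> (0 *\<^sub>R p) + w i * (norm (0 *\<^sub>R p))\<^sup>2) (at_right 0)"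
      by (intro tendsto_intros)
    moreover have "gradient (g i) x \<bullet> (0 *\<^sub>R p) + w i * (norm (0 *\<^sub>R p))\<^sup>2 < - \<alpha> * g i x"
      using False assms(1,2) i by (force simp: feasible_set_def mult_pos_neg)
    ultimately have "\<forall>\<^sub>F t in at_right 0.
        gradient (g i) x \<bullet> (t *\<^sub>R p) + w i * (norm (t *\<^sub>R p))\<^sup>2 < - \<alpha> * g i x"
      by (rule order_tendstoD)
    then show ?thesis
      by eventually_elim linarith
  qed
  then show ?thesis
    unfolding qcqp_feasible_def by (simp add: eventually_ball_finite_distrib)
qed

lemma MFCQ_inner_nonneg_imp_stationary:
  assumes "x \<in> feasible_set m g" "0 < \<alpha>" "MFCQ m g x"
    and nonneg: "\<And>v. qcqp_feasible m g \<alpha> w x v \<Longrightarrow> 0 \<le> gradient f x \<bullet> v"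
  shows "stationary m f g x"
proof -
  let ?A = "active_set m g x" and ?c = "gradient f x"
  obtain d where d: "\<And>i. i \<in> ?A \<Longrightarrow> gradient (g i) x \<bullet> d < 0"
    using assms(3) unfolding MFCQ_def by blast
  have "finite ?A"
    by (simp add: active_set_def)
  moreover have "- ?c \<bullet> y \<le> 0" if y: "\<forall>i\<in>?A. gradient (g i) x \<bullet> y \<le> 0" for y
  proof -
    have "0 \<le> ?c \<bullet> (y + e *\<^sub>R d)" if "0 < e" for e
    proof -
      \<comment> \<open>Adding \<open>e *\<^sub>R d\<close> makes the weak inequalities for
        \<open>y\<close> strict, as feasibility of small multiples requires.\<close>
      have "gradient (g i) x \<bullet> (y + e *\<^sub>R d) < 0" if "i \<in> ?A" for i
        using bspec[OF y that] mult_pos_neg[OF \<open>0 < e\<close> d[OF that]] by (simp add: inner_simps)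
      then have "\<forall>\<^sub>F t in at_right 0. qcqp_feasible m g \<alpha> w x (t *\<^sub>R (y + e *\<^sub>R d)) \<and> 0 < t"
        by (intro eventually_conj eventually_qcqp_feasible_scaleR[OF assms(1,2)]
            eventually_at_right_less)
      then obtain t where "qcqp_feasible m g \<alpha> w x (t *\<^sub>R (y + e *\<^sub>R d))" "0 < t"
        using eventually_happens'[OF trivial_limit_at_right_real] by blast
      with nonneg show ?thesis
        by (fastforce simp: zero_le_mult_iff)
    qed
    then have "\<forall>\<^sub>F e in at_right 0. 0 \<le> ?c \<bullet> (y + e *\<^sub>R d)"
      by (auto intro: eventually_mono[OF eventually_at_right_less])
    moreover have "((\<lambda>e. ?c \<bullet> (y + e *\<^sub>R d)) \<longlongrightarrow> ?c \<bullet> (y + 0 *\<^sub>R d)) (at_right 0)"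
      by (intro tendsto_intros)
    ultimately have "0 \<le> ?c \<bullet> (y + 0 *\<^sub>R d)"
      by (intro tendsto_lowerbound[where F = "at_right (0::real)"]) auto
    then show ?thesis
      by simp
  qed
  ultimately obtain lam where lam: "\<And>i. i \<in> ?A \<Longrightarrow> 0 \<le> lam i"
    "- ?c = (\<Sum>i\<in>?A. lam i *\<^sub>R gradient (g i) x)"
    using farkas[of ?A "\<lambda>i. gradient (g i) x" "- ?c"] by blast
  \<comment> \<open>Extension by zero off the active set yields complementary slackness.\<close>
  define mu where "mu i = (if i \<in> ?A then lam i else 0)" for i
  have "(\<Sum>i=1..m. mu i *\<^sub>R gradient (g i) x) = (\<Sum>i\<in>?A. lam i *\<^sub>R gradient (g i) x)"
    by (rule sum.mono_neutral_cong_right) (auto simp: mu_def active_set_def)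
  then have "?c + (\<Sum>i=1..m. mu i *\<^sub>R gradient (g i) x) = 0"
    using lam(2) by (metis add.right_inverse)
  moreover have "\<forall>i\<in>{1..m}. g i x \<le> 0"
    using assms(1) by (simp add: feasible_set_def)
  moreover have "\<forall>i\<in>{1..m}. 0 \<le> mu i" "\<forall>i\<in>{1..m}. mu i * g i x = 0"
    using lam(1) by (auto simp: mu_def active_set_def)
  ultimately show ?thesis
    unfolding stationary_def by blast
qed

theorem theorem1:
  fixes f :: "real ^ 'n \<Rightarrow> real" and g :: "nat \<Rightarrow> real ^ 'n \<Rightarrow> real"
    and m :: nat and L\<^sub>f \<alpha> :: real and L w :: "nat \<Rightarrow> real" and x xstar :: "real ^ 'n"
  assumes "continuously_differentiable f"
    and "\<And>i. i \<in> {1..m} \<Longrightarrow> continuously_differentiable (g i)"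
    and "L_smooth L\<^sub>f f"
    and "\<And>i. i \<in> {1..m} \<Longrightarrow> L_smooth (L i) (g i)"
    and "feasible_set m g \<noteq> {}"
    and "bdd_below (f ` feasible_set m g)"
    and "xstar \<in> feasible_set m g"
    and "\<And>y. y \<in> feasible_set m g \<Longrightarrow> f xstar \<le> f y"
    and "\<And>y. y \<in> feasible_set m g \<Longrightarrow> MFCQ m g y"
    and "\<alpha> > 0"
    and "\<And>i. i \<in> {1..m} \<Longrightarrow> w i > 0"
    and "x \<in> feasible_set m g"
  shows "(qcqp_direction m f g \<alpha> w x = 0 \<longleftrightarrow> stationary m f g x) \<and>
         gradient f x \<bullet> qcqp_direction m f g \<alpha> w x \<le> - (norm (qcqp_direction m f g \<alpha> w x))\<^sup>2"
proof -
  have w: "\<forall>i\<in>{1..m}. 0 \<le> w i"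
    using assms(11) by (simp add: less_imp_le)
  have \<alpha>: "0 \<le> \<alpha>"
    using assms(10) by simp
  have "MFCQ m g x"
    using assms(9,12) by blast
  \<comment> \<open>Both directions of the equivalence pass through nonnegativity of
    \<open>gradient f x\<close> on the QCQP feasible set.\<close>
  then show ?thesis
    using qcqp_direction_eq_0_iff[OF w \<alpha> assms(12), where f = f]
      qcqp_direction_descent[OF w \<alpha> assms(12), where f = f] stationary_imp_inner_nonneg[OF _ _ w]
      MFCQ_inner_nonneg_imp_stationary[OF assms(12,10)] by blast
qed

end
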